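(* Let $q\ge 2$ and $d\ge 1$ be integers and let $\mathbb{T}_{q+1}$ be the infinite $(q+1)$-regular tree. Let $\{\mu_u^n\}_{u,n}$ be a family of finitely supported probability measures on its vertices such that $\mu_u^n(v)=\mu_{u'}^n(v')$ whenever $\operatorname{dist}(u,v)=\operatorname{dist}(u',v')$, and write $g(\ell,n):=\mu_u^n(v)$ for $\operatorname{dist}(u,v)=\ell$. Let $X,Y$ be vertices with $\operatorname{dist}(X,Y)=d$. Then $W_1(\mu_X^n,\mu_Y^n)=S_1+S_2+S_3$, where \[ S_1 = 2 \sum_{h=0}^{\infty} q^h \left( g(h,n) - g(h+d, n) \right) \left( \tfrac{d}{2} + h \right),\qquad S_2 = 2 \sum_{i=1}^{\lfloor d/2 \rfloor} \left( g(i,n) - g(d-i,n) \right) \left( \tfrac{d}{2} - i \right), \] \[ S_3 = 2 \sum_{i=1}^{\lfloor d/2 \rfloor} \sum_{h=1}^{\infty} (q-1) q^{h-1} \left( g(i+h,n) - g(d-i+h,n) \right) \left( \tfrac{d}{2} - i + h \right). \]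
   Context: $W_1(\mu,\nu)$ is the $1$-Wasserstein distance: the minimum over couplings $\pi\ge0$ on $V\times V$ with marginals $\mu,\nu$ of $\sum_{v,w}\operatorname{dist}(v,w)\pi(v,w)$, where $\operatorname{dist}$ is graph distance. *)

theory Defs
  imports "HOL-Probability.Probability" "Graph_Theory.Graph_Theory"
begin

text \<open>
  A simple graph is a symmetric loop-free pair digraph, each undirected edge being represented by
  its two orientations. The predicate \<^const>\<open>tree\<close> of the library is not usable for such graphs:
  it forbids every directed cycle, hence also the cycle of length 2 running back and forth along
  an edge. Cycles of the undirected graph are the directed cycles of length at least 3.
  A \<open>k\<close>-regular tree with \<open>k \<ge> 2\<close> is automatically infinite.
\<close>

definition regular_tree :: "nat \<Rightarrow> 'a pair_pre_digraph \<Rightarrow> bool" where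
  "regular_tree k G \<longleftrightarrow>
     pair_bidirected_digraph G \<and>
     Digraph_Component.connected (with_proj G) \<and>
     \<not> (\<exists>p. pre_digraph.cycle (with_proj G) p \<and> length p \<ge> 3) \<and>
     (\<forall>v \<in> pverts G. finite (out_arcs (with_proj G) v) \<and> out_degree (with_proj G) v = k)"

definition graph_dist :: "'a pair_pre_digraph \<Rightarrow> 'a \<Rightarrow> 'a \<Rightarrow> nat" where
  "graph_dist G u v = (LEAST k. \<exists>p. pre_digraph.awalk (with_proj G) u p v \<and> length p = k)"

definition couplings :: "'a pmf \<Rightarrow> 'a pmf \<Rightarrow> ('a \<times> 'a) pmf set" where
  "couplings \<mu> \<nu> = {\<pi>. map_pmf fst \<pi> = \<mu> \<and> map_pmf snd \<pi> = \<nu>}"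

definition transport_cost :: "'a pair_pre_digraph \<Rightarrow> ('a \<times> 'a) pmf \<Rightarrow> real" where
  "transport_cost G \<pi> = measure_pmf.expectation \<pi> (\<lambda>(v, w). real (graph_dist G v w))"

text \<open>
  Integrability excludes couplings of infinite cost, to which the Bochner integral would assign
  the value 0; it holds for every coupling of finitely supported measures. The use of \<open>LEAST\<close>
  (rather than an infimum) means that an actual minimum is asserted.
\<close>

definition W1 :: "'a pair_pre_digraph \<Rightarrow> 'a pmf \<Rightarrow> 'a pmf \<Rightarrow> real" where
  "W1 G \<mu> \<nu> = (LEAST c. \<exists>\<pi> \<in> couplings \<mu> \<nu>.
     integrable (measure_pmf \<pi>) (\<lambda>(v, w). real (graph_dist G v w)) \<and> c = transport_cost G \<pi>)"

end

theory Submission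
  imports Defs
begin

text \<open>
  Removing an edge splits the tree into two half-trees, and the net flow through the edge is the
  difference of the masses that the two measures put on one of them. For a radial measure the
  half-tree beyond an edge, at distance \<open>m\<close> from the centre, has mass \<open>G m = (\<Sum>k. q ^ k * g (m + k))\<close>,
  and \<open>G m = g m + q * G (m + 1)\<close> makes \<open>G\<close> decreasing although \<open>g\<close> need not be. With
  \<open>g 0 + (q + 1) * G 1 = 1\<close>, hence \<open>G 1 \<le> 1 / 2\<close>, this shows that every edge carries its flow
  in the direction in which the signed distance \<open>f\<close> to the midpoint of the geodesic from
  \<open>X\<close> to \<open>Y\<close> decreases. The flow therefore yields a coupling that moves mass only along geodesics on
  which \<open>f\<close> drops at unit speed; as \<open>f\<close> is 1-Lipschitz, this coupling is optimal and
  \<open>W1\<close> is the difference of the integrals of \<open>f\<close>. Summing \<open>f\<close> over the vertices sorted by their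
  projection to the geodesic and their height above it gives the three series.
\<close>

section \<open>Couplings from flows\<close>

lemma pmf_bind_return_pmf_upd:
  "pmf (bind_pmf \<mu> (return_pmf(v := \<kappa>))) x = pmf \<mu> x + pmf \<mu> v * (pmf \<kappa> x - indicator {v} x)"
proof -
  have integrable: "integrable (measure_pmf \<mu>) (indicat_real A)" for A
    by (rule integrable_real_indicator) (auto simp: measure_pmf.emeasure_finite less_top[symmetric])
  have "pmf ((return_pmf(v := \<kappa>)) y) x =
      indicator {x} y + indicator {v} y * (pmf \<kappa> x - indicator {v} x)" for y
    by (auto simp: indicator_def)
  then have "pmf (bind_pmf \<mu> (return_pmf(v := \<kappa>))) x =
      (\<integral>y. indicator {x} y + indicator {v} y * (pmf \<kappa> x - indicator {v} x) \<partial>measure_pmf \<mu>)"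
    by (simp only: pmf_bind)
  also have "\<dots> = pmf \<mu> x + pmf \<mu> v * (pmf \<kappa> x - indicator {v} x)"
    by (simp add: Bochner_Integration.integral_add integrable measure_pmf_single)
  finally show ?thesis .
qed

lemma rel_pmf_bind_return_pmf_upd:
  assumes "reflp R" and "\<And>w. w \<in> set_pmf \<kappa> \<Longrightarrow> R v w"
  shows "rel_pmf R \<mu> (bind_pmf \<mu> (return_pmf(v := \<kappa>)))"
proof -
  have "rel_pmf R (bind_pmf \<mu> return_pmf) (bind_pmf \<mu> (return_pmf(v := \<kappa>)))"
  proof (rule rel_pmf_bindI)
    show "rel_pmf (=) \<mu> \<mu>" by (simp add: pmf.rel_eq)
    show "rel_pmf R (return_pmf x) ((return_pmf(v := \<kappa>)) y)" if "x = y" for x y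
      using that assms by (auto simp: rel_pmf_return_pmf1 reflp_def)
  qed
  then show ?thesis by (simp add: bind_return_pmf')
qed

lemma rel_pmf_move_mass:
  assumes "0 \<le> m" "m \<le> pmf \<mu> v" and "v \<noteq> w" and "reflp R" "R v w"
  obtains \<mu>' where "rel_pmf R \<mu> \<mu>'"
    and "\<And>x. pmf \<mu>' x = pmf \<mu> x + m * (indicator {w} x - indicator {v} x)"
proof -
  define p where "p = m / pmf \<mu> v"
  have p_bounds: "0 \<le> p" "p \<le> 1" and mass: "pmf \<mu> v * p = m"
    using assms(1,2) by (auto simp: p_def divide_le_eq_1)
  define \<kappa> where "\<kappa> = map_pmf (\<lambda>b. if b then w else v) (bernoulli_pmf p)"
  have "(\<lambda>b. if b then w else v) -` {x} =
      (if x = w then {True} else if x = v then {False} else {})" for x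
    using \<open>v \<noteq> w\<close> by (auto split: if_splits)
  then have "pmf \<kappa> x - indicator {v} x = p * (indicator {w} x - indicator {v} x)" for x
    using p_bounds \<open>v \<noteq> w\<close> by (auto simp: \<kappa>_def pmf_map measure_pmf_single indicator_def)
  then have "pmf (bind_pmf \<mu> (return_pmf(v := \<kappa>))) x =
      pmf \<mu> x + m * (indicator {w} x - indicator {v} x)" for x
    by (simp add: pmf_bind_return_pmf_upd mass flip: mult.assoc)
  moreover have "rel_pmf R \<mu> (bind_pmf \<mu> (return_pmf(v := \<kappa>)))"
    using assms(4,5) by (intro rel_pmf_bind_return_pmf_upd) (auto simp: \<kappa>_def reflp_def)
  ultimately show thesis using that by blast
qed

definition flow_on ::
    "'a set \<Rightarrow> ('a \<Rightarrow> 'a \<Rightarrow> bool) \<Rightarrow> ('a \<Rightarrow> 'a \<Rightarrow> real) \<Rightarrow> 'a pmf \<Rightarrow> 'a pmf \<Rightarrow> bool" where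
  "flow_on B R \<phi> \<mu> \<nu> \<longleftrightarrow> finite B \<and> (\<forall>v w. 0 \<le> \<phi> v w) \<and>
     (\<forall>v w. \<phi> v w \<noteq> 0 \<longrightarrow> v \<in> B \<and> w \<in> B \<and> R v w) \<and>
     (\<forall>v. pmf \<mu> v - pmf \<nu> v = (\<Sum>w\<in>B. \<phi> v w) - (\<Sum>w\<in>B. \<phi> w v))"

definition flow_arcs :: "('a \<Rightarrow> 'a \<Rightarrow> real) \<Rightarrow> ('a \<times> 'a) set" where
  "flow_arcs \<phi> = {(v, w). \<phi> v w \<noteq> 0}"

lemma finite_flow_arcs: "flow_on B R \<phi> \<mu> \<nu> \<Longrightarrow> finite (flow_arcs \<phi>)"
  by (rule finite_subset[of _ "B \<times> B"]) (auto simp: flow_on_def flow_arcs_def)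

text \<open>
  Where \<open>f\<close> is maximal among the tails of the arcs carrying flow, no flow comes in, so there is
  enough mass to send the whole flow through any outgoing arc at once.
\<close>

lemma flow_on_obtains_source_arc:
  fixes f :: "'a \<Rightarrow> real"
  assumes flow: "flow_on B R \<phi> \<mu> \<nu>" and "flow_arcs \<phi> \<noteq> {}"
    and decreasing: "\<And>v w. R v w \<Longrightarrow> f w < f v"
  obtains v w where "(v, w) \<in> flow_arcs \<phi>" "\<phi> v w \<le> pmf \<mu> v"
proof -
  obtain v w where arc: "(v, w) \<in> flow_arcs \<phi>"
    and max: "\<And>x y. (x, y) \<in> flow_arcs \<phi> \<Longrightarrow> f x \<le> f v"
    using assms(2) ex_is_arg_min_if_finite[OF finite_flow_arcs[OF flow], of "\<lambda>(x, y). - f x"]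
    by (fastforce simp: is_arg_min_linorder)
  have "\<phi> u v = 0" for u
    using flow max[of u v] decreasing[of u v] by (fastforce simp: flow_arcs_def flow_on_def)
  then have "pmf \<mu> v = pmf \<nu> v + (\<Sum>x\<in>B. \<phi> v x)"
    using flow by (simp add: flow_on_def diff_eq_eq)
  moreover have "\<phi> v w \<le> (\<Sum>x\<in>B. \<phi> v x)"
    using flow arc by (intro member_le_sum) (auto simp: flow_on_def flow_arcs_def)
  ultimately have "\<phi> v w \<le> pmf \<mu> v" by (simp add: add_increasing)
  with arc show thesis by (rule that)
qed

lemma flow_on_remove_arc:
  assumes flow: "flow_on B R \<phi> \<mu> \<nu>" and arc: "(v, w) \<in> flow_arcs \<phi>"
    and moved: "\<And>x. pmf \<mu>' x = pmf \<mu> x + \<phi> v w * (indicator {w} x - indicator {v} x)"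
  shows "flow_on B R (\<phi>(v := (\<phi> v)(w := 0))) \<mu>' \<nu>" (is "flow_on B R ?\<phi>' \<mu>' \<nu>")
proof -
  have ends: "v \<in> B" "w \<in> B" using assms by (auto simp: flow_on_def flow_arcs_def)
  have removed: "?\<phi>' x y = \<phi> x y - \<phi> v w * indicator {v} x * indicator {w} y" for x y
    by (auto simp: indicator_def)
  have sum_indicator: "(\<Sum>x\<in>B. indicat_real {u} x) = 1" if "u \<in> B" for u
    using flow that by (simp add: flow_on_def indicator_def of_bool_def)
  have "pmf \<mu>' x - pmf \<nu> x = (\<Sum>y\<in>B. ?\<phi>' x y) - (\<Sum>y\<in>B. ?\<phi>' y x)" for x
    using flow ends
    by (simp only: removed) (simp add: flow_on_def moved sum_subtractf sum_indicator algebra_simps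
        flip: sum_distrib_left sum_distrib_right)
  then show ?thesis using flow by (auto simp: flow_on_def)
qed

lemma flow_on_imp_rel_pmf:
  fixes f :: "'a \<Rightarrow> real"
  assumes "flow_on B R \<phi> \<mu> \<nu>" and decreasing: "\<And>v w. R v w \<Longrightarrow> f w < f v"
  shows "rel_pmf R\<^sup>*\<^sup>* \<mu> \<nu>"
  using assms(1)
proof (induction "card (flow_arcs \<phi>)" arbitrary: \<mu> \<phi> rule: less_induct)
  case less
  show ?case
  proof (cases "flow_arcs \<phi> = {}")
    case True
    then have "\<mu> = \<nu>" using less.prems by (intro pmf_eqI) (simp add: flow_on_def flow_arcs_def)
    then show ?thesis by (simp add: rel_pmf_reflI)
  next
    case False
    then obtain v w where arc: "(v, w) \<in> flow_arcs \<phi>" and enough: "\<phi> v w \<le> pmf \<mu> v"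
      using flow_on_obtains_source_arc[where f = f, OF less.prems] decreasing by metis
    then have "R v w" "0 \<le> \<phi> v w" using less.prems by (auto simp: flow_on_def flow_arcs_def)
    moreover from this have "v \<noteq> w" using decreasing by fastforce
    ultimately obtain \<mu>' where moved: "rel_pmf R\<^sup>*\<^sup>* \<mu> \<mu>'"
      and pmf_\<mu>': "\<And>x. pmf \<mu>' x = pmf \<mu> x + \<phi> v w * (indicator {w} x - indicator {v} x)"
      using enough rel_pmf_move_mass[of "\<phi> v w" \<mu> v w "R\<^sup>*\<^sup>*"] by (auto simp: reflp_def)
    have "flow_arcs (\<phi>(v := (\<phi> v)(w := 0))) = flow_arcs \<phi> - {(v, w)}"
      by (auto simp: flow_arcs_def split: if_splits)
    then have "card (flow_arcs (\<phi>(v := (\<phi> v)(w := 0)))) < card (flow_arcs \<phi>)"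
      using card_Diff1_less[OF finite_flow_arcs[OF less.prems] arc] by simp
    then have "rel_pmf R\<^sup>*\<^sup>* \<mu>' \<nu>"
      by (rule less.hyps) (rule flow_on_remove_arc[OF less.prems arc pmf_\<mu>'])
    with moved have "rel_pmf (R\<^sup>*\<^sup>* OO R\<^sup>*\<^sup>*) \<mu> \<nu>" by (auto simp: pmf.rel_compp)
    then show ?thesis by (rule pmf.rel_mono_strong) auto
  qed
qed

lemma set_pmf_coupling:
  assumes "\<pi> \<in> couplings \<mu> \<nu>"
  shows "set_pmf \<pi> \<subseteq> set_pmf \<mu> \<times> set_pmf \<nu>"
proof -
  have "set_pmf \<mu> = fst ` set_pmf \<pi>" "set_pmf \<nu> = snd ` set_pmf \<pi>"
    using assms by (simp_all add: couplings_def flip: set_map_pmf)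
  then show ?thesis by force
qed

lemma integrable_coupling:
  fixes h :: "'a \<times> 'a \<Rightarrow> real"
  assumes "finite (set_pmf \<mu>)" "finite (set_pmf \<nu>)" "\<pi> \<in> couplings \<mu> \<nu>"
  shows "integrable (measure_pmf \<pi>) h"
  using finite_subset[OF set_pmf_coupling[OF assms(3)]] assms(1,2)
  by (intro integrable_measure_pmf_finite) blast

lemma expectation_diff_coupling:
  fixes f :: "'a \<Rightarrow> real"
  assumes "finite (set_pmf \<mu>)" "finite (set_pmf \<nu>)" "\<pi> \<in> couplings \<mu> \<nu>"
  shows "measure_pmf.expectation \<pi> (\<lambda>(v, w). f v - f w) =
    measure_pmf.expectation \<mu> f - measure_pmf.expectation \<nu> f"
proof -
  have "map_pmf fst \<pi> = \<mu>" "map_pmf snd \<pi> = \<nu>"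
    using assms(3) by (auto simp: couplings_def)
  then show ?thesis
    using integrable_coupling[OF assms] by (auto simp: case_prod_beta')
qed

lemma W1_eq_expectation_diff:
  fixes f :: "'a \<Rightarrow> real"
  assumes finite: "finite (set_pmf \<mu>)" "finite (set_pmf \<nu>)"
    and lipschitz: "\<And>v w. v \<in> set_pmf \<mu> \<Longrightarrow> w \<in> set_pmf \<nu> \<Longrightarrow> f v - f w \<le> real (graph_dist G v w)"
    and tight: "rel_pmf (\<lambda>v w. real (graph_dist G v w) \<le> f v - f w) \<mu> \<nu>"
  shows "W1 G \<mu> \<nu> = measure_pmf.expectation \<mu> f - measure_pmf.expectation \<nu> f"
proof -
  let ?cost = "\<lambda>(v, w). real (graph_dist G v w)" and ?drop = "\<lambda>(v, w). f v - f w"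
  have lower: "measure_pmf.expectation \<mu> f - measure_pmf.expectation \<nu> f \<le> transport_cost G \<pi>"
    if "\<pi> \<in> couplings \<mu> \<nu>" for \<pi>
  proof -
    have "measure_pmf.expectation \<pi> ?drop \<le> measure_pmf.expectation \<pi> ?cost"
      using set_pmf_coupling[OF that] lipschitz
      by (intro integral_mono_AE integrable_coupling[OF finite that]) (auto simp: AE_measure_pmf_iff)
    then show ?thesis
      by (simp add: transport_cost_def expectation_diff_coupling[OF finite that])
  qed
  obtain \<pi> where coupling: "\<pi> \<in> couplings \<mu> \<nu>"
    and cost_le_drop: "\<And>v w. (v, w) \<in> set_pmf \<pi> \<Longrightarrow> ?cost (v, w) \<le> ?drop (v, w)"
    using tight by (auto simp: couplings_def elim: rel_pmf.cases)
  have "measure_pmf.expectation \<pi> ?cost \<le> measure_pmf.expectation \<pi> ?drop"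
    using cost_le_drop by (intro integral_mono_AE integrable_coupling[OF finite coupling]) (auto simp: AE_measure_pmf_iff)
  with lower[OF coupling]
  have optimal: "measure_pmf.expectation \<mu> f - measure_pmf.expectation \<nu> f = transport_cost G \<pi>"
    by (simp add: transport_cost_def expectation_diff_coupling[OF finite coupling])
  show ?thesis
    unfolding W1_def
  proof (rule Least_equality)
    show "\<exists>\<pi>\<in>couplings \<mu> \<nu>. integrable (measure_pmf \<pi>) ?cost \<and>
        measure_pmf.expectation \<mu> f - measure_pmf.expectation \<nu> f = transport_cost G \<pi>"
      using coupling optimal integrable_coupling[OF finite coupling] by blast
  qed (use lower in auto)
qed

section \<open>Graph distance\<close>

lemma length_rev_path [simp]: "length (rev_path p) = length p"
  by (induction p) simp_all

locale connected_pair_graph = pair_bidirected_digraph G for G :: "'a pair_pre_digraph" +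
  assumes connected: "Digraph_Component.connected (with_proj G)"
begin

abbreviation V :: "'a set" where "V \<equiv> pverts G"
abbreviation adj :: "'a \<Rightarrow> 'a \<Rightarrow> bool" where "adj v w \<equiv> (v, w) \<in> parcs G"
abbreviation nbrs :: "'a \<Rightarrow> 'a set" where "nbrs v \<equiv> {w. adj v w}"
abbreviation \<delta> :: "'a \<Rightarrow> 'a \<Rightarrow> nat" where "\<delta> \<equiv> graph_dist G"

lemma graph_dist_le_length: "awalk u p v \<Longrightarrow> \<delta> u v \<le> length p"
  unfolding graph_dist_def by (rule Least_le) blast

lemma shortest_awalk_exists:
  assumes "u \<in> V" "v \<in> V"
  obtains p where "awalk u p v" "length p = \<delta> u v"
proof -
  have "strongly_connected (with_proj G)"
    using symmetric_connected_imp_strongly_connected pair_sym_arcs connected by blast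
  then have "\<exists>p. awalk u p v"
    using assms by (simp add: strongly_connected_def reachable_awalk)
  then have "\<exists>p. awalk u p v \<and> length p = \<delta> u v"
    unfolding graph_dist_def by (rule LeastI_ex[OF exE]) blast
  then show thesis using that by blast
qed

lemma graph_dist_self [simp]: "u \<in> V \<Longrightarrow> \<delta> u u = 0"
  using graph_dist_le_length[of u "[]" u] by (simp add: awalk_Nil_iff)

lemma graph_dist_eq_0_iff: "u \<in> V \<Longrightarrow> v \<in> V \<Longrightarrow> \<delta> u v = 0 \<longleftrightarrow> u = v"
  by (metis awalk_empty_ends graph_dist_self length_0_conv shortest_awalk_exists)

lemma graph_dist_triangle:
  assumes "u \<in> V" "v \<in> V" "w \<in> V"
  shows "\<delta> u w \<le> \<delta> u v + \<delta> v w"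
proof -
  obtain p r where "awalk u p v" "length p = \<delta> u v" "awalk v r w" "length r = \<delta> v w"
    using shortest_awalk_exists assms by metis
  then show ?thesis using graph_dist_le_length[of u "p @ r" w] awalk_appendI by fastforce
qed

lemma graph_dist_commute:
  assumes "u \<in> V" "v \<in> V"
  shows "\<delta> u v = \<delta> v u"
proof -
  have "\<delta> v u \<le> \<delta> u v" if "u \<in> V" "v \<in> V" for u v
    using shortest_awalk_exists[OF that] graph_dist_le_length[of v "rev_path _" u]
    by (metis awalk_rev_path length_rev_path)
  then show ?thesis using assms by (simp add: antisym)
qed

lemma graph_dist_le_add:
  assumes "x \<in> V" "y \<in> V" "v \<in> V"
  shows "\<delta> x y \<le> \<delta> x v + \<delta> y v"
  using graph_dist_triangle[of x v y] graph_dist_commute[of v y] assms by simp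

lemma graph_dist_adj: "adj u v \<Longrightarrow> \<delta> u v = 1"
  using graph_dist_le_length[of u "[(u, v)]" v] graph_dist_eq_0_iff[of u v] no_loops'[of u v]
  by (force simp: awalk_simps dest: in_arcsD1 in_arcsD2)

lemma graph_dist_adj_le: "u \<in> V \<Longrightarrow> adj v w \<Longrightarrow> \<delta> u w \<le> Suc (\<delta> u v)"
  using graph_dist_triangle[of u v w] graph_dist_adj[of v w] by (simp add: in_arcsD1 in_arcsD2)

definition nearer_nbrs :: "'a \<Rightarrow> 'a \<Rightarrow> 'a set" where
  "nearer_nbrs u v = {w \<in> nbrs v. \<delta> u v = Suc (\<delta> u w)}"

definition farther_nbrs :: "'a \<Rightarrow> 'a \<Rightarrow> 'a set" where
  "farther_nbrs u v = {w \<in> nbrs v. \<delta> u w = Suc (\<delta> u v)}"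

lemma farther_nbrs_iff_nearer_nbrs: "w \<in> farther_nbrs u v \<longleftrightarrow> v \<in> nearer_nbrs u w"
  by (auto simp: farther_nbrs_def nearer_nbrs_def intro: arcs_symmetric)

lemma nearer_nbrs_nonempty:
  assumes "u \<in> V" "v \<in> V" "u \<noteq> v"
  shows "nearer_nbrs u v \<noteq> {}"
proof -
  obtain p where geodesic: "awalk v p u" "length p = \<delta> u v"
    using shortest_awalk_exists[OF assms(2,1)] graph_dist_commute[OF assms(1,2)] by metis
  then obtain w p' where "p = (v, w) # p'" "adj v w" "awalk w p' u"
    using assms(3) by (cases p) (auto simp: awalk_simps)
  then have "\<delta> u w < \<delta> u v"
    using geodesic(2) graph_dist_le_length[of w p' u] graph_dist_commute[OF assms(1), of w]
    by (auto dest: in_arcsD2)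
  then have "\<delta> u v = Suc (\<delta> u w)"
    using graph_dist_adj_le[OF assms(1) arcs_symmetric[OF \<open>adj v w\<close>]] by simp
  with \<open>adj v w\<close> show ?thesis by (auto simp: nearer_nbrs_def)
qed

lemma graph_dist_induct [consumes 2, case_names base step]:
  assumes "u \<in> V" "v \<in> V"
    and base: "P u"
    and step: "\<And>v w. v \<in> V \<Longrightarrow> w \<in> nearer_nbrs u v \<Longrightarrow> P w \<Longrightarrow> P v"
  shows "P v"
  using assms(2)
proof (induction "\<delta> u v" arbitrary: v)
  case 0
  then show ?case using graph_dist_eq_0_iff[OF assms(1)] base by metis
next
  case (Suc m)
  then have "u \<noteq> v" using assms(1) by auto
  then obtain w where nearer: "w \<in> nearer_nbrs u v"
    using nearer_nbrs_nonempty[OF assms(1) Suc.prems] by blast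
  then have "P w" using Suc by (auto simp: nearer_nbrs_def dest: in_arcsD2)
  then show ?case using step[OF Suc.prems nearer] by blast
qed

lemma geodesic_point_exists:
  assumes "x \<in> V" "y \<in> V" "i \<le> \<delta> x y"
  shows "\<exists>v\<in>V. \<delta> x v = i \<and> \<delta> y v = \<delta> x y - i"
  using assms(3)
proof (induction i)
  case 0
  show ?case using assms graph_dist_commute[of x y] by force
next
  case (Suc i)
  then obtain v where point: "v \<in> V" "\<delta> x v = i" "\<delta> y v = \<delta> x y - i" by auto
  then have "y \<noteq> v" using Suc.prems assms(2) by auto
  then obtain w where adj: "adj v w" "\<delta> y v = Suc (\<delta> y w)"
    using nearer_nbrs_nonempty[OF assms(2) point(1)] by (auto simp: nearer_nbrs_def)
  then have "w \<in> V" by (auto dest: in_arcsD2)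
  moreover have "\<delta> x w = Suc i"
    using adj point Suc.prems graph_dist_adj_le[OF assms(1) adj(1)] graph_dist_le_add[OF assms(1,2) \<open>w \<in> V\<close>]
    by simp
  ultimately show ?case using adj point by auto
qed

lemma nearer_nbrs_disjoint_on_geodesic:
  assumes "x \<in> V" "y \<in> V" "\<delta> x v + \<delta> y v = \<delta> x y"
  shows "nearer_nbrs x v \<inter> nearer_nbrs y v = {}"
proof -
  have "\<delta> x w + \<delta> y w < \<delta> x y" if "w \<in> nearer_nbrs x v" "w \<in> nearer_nbrs y v" for w
    using that assms(3) by (simp add: nearer_nbrs_def)
  moreover have "\<delta> x y \<le> \<delta> x w + \<delta> y w" if "w \<in> nearer_nbrs x v" for w
    using that graph_dist_le_add[OF assms(1,2)] by (auto simp: nearer_nbrs_def dest: in_arcsD2)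
  ultimately show ?thesis by fastforce
qed

lemma lipschitz_of_adj:
  fixes f :: "'a \<Rightarrow> real"
  assumes "\<And>v w. adj v w \<Longrightarrow> f v - f w \<le> 1" and "u \<in> V" "v \<in> V"
  shows "f u - f v \<le> real (\<delta> u v)"
  using assms(2,3)
proof (induction rule: graph_dist_induct)
  case (step v w)
  then have "adj w v" "\<delta> u v = Suc (\<delta> u w)" by (auto simp: nearer_nbrs_def arcs_symmetric)
  then show ?case using step(3) assms(1)[of w v] by simp
qed (use assms in simp)

lemma graph_dist_le_descent:
  fixes f :: "'a \<Rightarrow> real"
  assumes "(\<lambda>v w. adj v w \<and> f v = f w + 1)\<^sup>*\<^sup>* u v" "u \<in> V"
  shows "real (\<delta> u v) \<le> f u - f v"
  using assms(1)
proof induction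
  case (step v w)
  then show ?case using graph_dist_adj_le[OF assms(2), of v w] by simp
qed (use assms(2) in simp)

lemma finite_ball_of_finite_nbrs:
  assumes "\<And>v. v \<in> V \<Longrightarrow> finite (nbrs v)" and "u \<in> V"
  shows "finite {v \<in> V. \<delta> u v \<le> r}"
proof (induction r)
  case 0
  have "{v \<in> V. \<delta> u v \<le> 0} = {u}" using graph_dist_eq_0_iff assms(2) by auto
  then show ?case by simp
next
  case (Suc r)
  have "\<exists>w\<in>{w \<in> V. \<delta> u w \<le> r}. adj w v" if point: "v \<in> V" "\<delta> u v \<le> Suc r" "u \<noteq> v" for v
  proof -
    obtain w where "w \<in> nearer_nbrs u v" using nearer_nbrs_nonempty[OF assms(2) point(1,3)] by blast
    then have "w \<in> V" "\<delta> u w \<le> r" "adj w v"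
      using point(2) by (auto simp: nearer_nbrs_def arcs_symmetric dest: in_arcsD2)
    then show ?thesis by blast
  qed
  then have "{v \<in> V. \<delta> u v \<le> Suc r} \<subseteq> {u} \<union> (\<Union>w\<in>{w \<in> V. \<delta> u w \<le> r}. nbrs w)" by blast
  then show ?case using Suc assms(1) by (blast intro: finite_subset finite_UN_I)
qed

end

section \<open>Trees\<close>

locale pair_tree = connected_pair_graph +
  assumes cycle_short: "cycle p \<Longrightarrow> length p < 3"
begin

lemma awalk_between_nbrs:
  assumes "adj v w" "adj v w'" "w \<noteq> w'" "awalk w p w'"
  shows "v \<in> set (pawalk_verts w p)"
proof (rule ccontr)
  assume avoid: "v \<notin> set (pawalk_verts w p)"
  define r where "r = awalk_to_apath p"
  have path: "awalk w r w'" "distinct (pawalk_verts w r)"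
    using apath_awalk_to_apath[OF assms(4)] by (auto simp: r_def apath_def)
  have "set (pawalk_verts w r) \<subseteq> set (pawalk_verts w p)"
    using awalk_to_apath_subset[OF assms(4)] set_awalk_verts[OF assms(4)] set_awalk_verts[OF path(1)]
    by (auto simp: r_def)
  then have "v \<notin> set (pawalk_verts w r)" using avoid by blast
  moreover have walk_back: "awalk w (r @ [(w', v)]) v"
    using path(1) assms(2) by (auto simp: awalk_simps arcs_symmetric intro: in_arcsD1 in_arcsD2)
  moreover have "pawalk_verts w (r @ [(w', v)]) = pawalk_verts w r @ [v]"
    using awalk_verts_append[OF walk_back] by simp
  ultimately have "cycle ((v, w) # r @ [(w', v)])"
    using path(2) assms(1) unfolding cycle_def
    by (intro exI[of _ v]) (auto simp: awalk_Cons_iff)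
  moreover have "r \<noteq> []" using path(1) assms(3) by auto
  ultimately show False using cycle_short by fastforce
qed

text \<open>
  Two distinct such neighbours would be joined by the geodesics to \<open>u\<close>, which avoid \<open>v\<close>, and the
  edges at \<open>v\<close> would complete this walk to a cycle.
\<close>

lemma nonfarther_nbr_unique:
  assumes "u \<in> V" "adj v w" "adj v w'" "\<delta> u w \<le> \<delta> u v" "\<delta> u w' \<le> \<delta> u v"
  shows "w = w'"
proof (rule ccontr)
  assume "w \<noteq> w'"
  have avoid: "v \<notin> set (pawalk_verts w p)"
    if nonfarther: "adj v w" "\<delta> u w \<le> \<delta> u v" and geodesic: "awalk w p u" "length p = \<delta> u w" for w p
  proof
    assume "v \<in> set (pawalk_verts w p)"
    then obtain q r where split: "p = q @ r" "awalk w q v" "awalk v r u"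
      using awalk_decomp[OF geodesic(1)] by blast
    then have "length q > 0" using no_loops'[OF nonfarther(1)] by auto
    moreover have "\<delta> u v \<le> length r"
      using graph_dist_le_length[OF split(3)] graph_dist_commute[OF assms(1) in_arcsD1[OF nonfarther(1)]] by simp
    moreover have "length q + length r = \<delta> u w" using geodesic(2) split(1) by simp
    ultimately show False using nonfarther(2) by linarith
  qed
  have ends: "w \<in> V" "w' \<in> V" using assms in_arcsD2 by auto
  obtain p p' where geodesics: "awalk w p u" "length p = \<delta> u w" "awalk w' p' u" "length p' = \<delta> u w'"
    using shortest_awalk_exists[OF _ assms(1)] graph_dist_commute[OF assms(1)] ends by metis
  then have "v \<notin> set (pawalk_verts w (p @ rev_path p'))"
    using avoid[OF assms(2,4)] avoid[OF assms(3,5)]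
    by (simp add: set_awalk_verts_append awalk_verts_rev_path)
  then show False
    using awalk_between_nbrs[OF assms(2,3) \<open>w \<noteq> w'\<close>] geodesics by (metis awalk_appendI awalk_rev_path)
qed

lemma nearer_nbr_unique:
  assumes "u \<in> V" "w \<in> nearer_nbrs u v" "w' \<in> nearer_nbrs u v"
  shows "w = w'"
  using assms nonfarther_nbr_unique[of u v w w'] by (simp add: nearer_nbrs_def)

lemma nbrs_eq_nearer_Un_farther:
  assumes "u \<in> V"
  shows "nbrs v = nearer_nbrs u v \<union> farther_nbrs u v"
proof (intro equalityI subsetI)
  fix w assume "w \<in> nbrs v"
  then have adj: "adj v w" by simp
  have "\<delta> u v \<noteq> \<delta> u w"
  proof
    assume equidistant: "\<delta> u v = \<delta> u w"
    have "u \<noteq> v" using equidistant adj assms graph_dist_eq_0_iff[of u w] no_loops'[OF adj] by (force dest: in_arcsD2)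
    then obtain x where "x \<in> nearer_nbrs u v"
      using nearer_nbrs_nonempty[OF assms in_arcsD1[OF adj]] by blast
    then show False using nonfarther_nbr_unique[OF assms adj, of x] equidistant by (auto simp: nearer_nbrs_def)
  qed
  then show "w \<in> nearer_nbrs u v \<union> farther_nbrs u v"
    using graph_dist_adj_le[OF assms adj] graph_dist_adj_le[OF assms arcs_symmetric[OF adj]] adj
    by (auto simp: nearer_nbrs_def farther_nbrs_def)
qed (auto simp: nearer_nbrs_def farther_nbrs_def)

lemma nearer_farther_nbrs_disjoint: "nearer_nbrs u v \<inter> farther_nbrs u v = {}"
  by (auto simp: nearer_nbrs_def farther_nbrs_def)

lemma adj_cases:
  assumes "u \<in> V" "adj v w"
  obtains (nearer) "\<delta> u v = Suc (\<delta> u w)" | (farther) "\<delta> u w = Suc (\<delta> u v)"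
  using assms nbrs_eq_nearer_Un_farther[OF assms(1), of v]
  by (auto simp: nearer_nbrs_def farther_nbrs_def)

lemma nearer_nbrs_eq_singleton:
  assumes "u \<in> V" "v \<in> V" "u \<noteq> v"
  obtains w where "nearer_nbrs u v = {w}"
  using nearer_nbrs_nonempty[OF assms] nearer_nbr_unique[OF assms(1)] by blast

lemma nearer_nbrs_self [simp]: "u \<in> V \<Longrightarrow> nearer_nbrs u u = {}"
  by (simp add: nearer_nbrs_def)

lemma card_nearer_nbrs:
  assumes "u \<in> V" "v \<in> V"
  shows "card (nearer_nbrs u v) = (if u = v then 0 else 1)"
  using assms by (auto elim: nearer_nbrs_eq_singleton)

lemma finite_nearer_nbrs:
  assumes "u \<in> V"
  shows "finite (nearer_nbrs u v)"
proof (cases "nearer_nbrs u v = {}")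
  case False
  then obtain w where "w \<in> nearer_nbrs u v" by blast
  then have "nearer_nbrs u v = {w}" using nearer_nbr_unique[OF assms] by blast
  then show ?thesis by simp
qed simp

lemma graph_dist_eq_add:
  assumes "x \<in> V" "y \<in> V" "w \<in> farther_nbrs x v" "w \<in> nearer_nbrs y v"
  shows "\<delta> x v + \<delta> y v = \<delta> x y"
proof -
  have "w \<in> V" using assms(3) by (auto simp: farther_nbrs_def dest: in_arcsD2)
  with assms(2) show ?thesis
    using assms(3,4)
  proof (induction arbitrary: v rule: graph_dist_induct)
    case base
    then show ?case using assms(2) by (simp add: farther_nbrs_def nearer_nbrs_def)
  next
    case (step w z)
    then have "v \<in> nearer_nbrs x w" by (simp add: farther_nbrs_iff_nearer_nbrs)
    moreover have "z \<noteq> v" using step.hyps step.prems by (auto simp: nearer_nbrs_def)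
    ultimately have "z \<notin> nearer_nbrs x w" using nearer_nbr_unique[OF assms(1)] by blast
    moreover have "z \<in> nbrs w" using step.hyps by (simp add: nearer_nbrs_def)
    ultimately have "z \<in> farther_nbrs x w" using nbrs_eq_nearer_Un_farther[OF assms(1)] by blast
    then have "\<delta> x w + \<delta> y w = \<delta> x y" using step.IH step.hyps by blast
    then show ?case using step.prems by (simp add: farther_nbrs_def nearer_nbrs_def)
  qed
qed

text \<open>The vertices on the side of \<open>v\<close> when the edge between \<open>v\<close> and \<open>w\<close> is removed.\<close>

definition half_tree :: "'a \<Rightarrow> 'a \<Rightarrow> 'a set" where
  "half_tree v w = {x \<in> V. v \<in> nearer_nbrs x w}"

lemma half_tree_Un: "adj v w \<Longrightarrow> half_tree v w \<union> half_tree w v = V"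
  using nbrs_eq_nearer_Un_farther
  by (fastforce simp: half_tree_def farther_nbrs_iff_nearer_nbrs)

lemma half_tree_disjoint: "half_tree v w \<inter> half_tree w v = {}"
  by (auto simp: half_tree_def nearer_nbrs_def)

lemma UN_half_tree:
  assumes "v \<in> V"
  shows "(\<Union>w\<in>nbrs v. half_tree w v) = V - {v}"
  using assms nearer_nbrs_nonempty[of _ v] by (auto simp: half_tree_def nearer_nbrs_def)

lemma half_trees_at_vertex_disjoint: "w \<noteq> w' \<Longrightarrow> half_tree w v \<inter> half_tree w' v = {}"
  using nearer_nbr_unique by (auto simp: half_tree_def)

lemma graph_dist_half_tree:
  assumes "u \<in> V" "w \<in> farther_nbrs u v" "x \<in> half_tree w v"
  shows "\<delta> u w \<le> \<delta> u x"
  using graph_dist_eq_add[of u x w v] assms by (simp add: half_tree_def farther_nbrs_def nearer_nbrs_def)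

lemma prob_half_tree_swap:
  assumes "set_pmf \<rho> \<subseteq> V" "adj v w"
  shows "measure_pmf.prob \<rho> (half_tree w v) = 1 - measure_pmf.prob \<rho> (half_tree v w)"
proof -
  have "measure_pmf.prob \<rho> (half_tree v w \<union> half_tree w v) =
      measure_pmf.prob \<rho> (half_tree v w) + measure_pmf.prob \<rho> (half_tree w v)"
    by (intro measure_pmf.finite_measure_Union half_tree_disjoint) auto
  moreover have "measure_pmf.prob \<rho> V = 1"
    using assms(1) by (auto simp: measure_pmf.prob_eq_1 AE_measure_pmf_iff)
  ultimately show ?thesis by (simp add: half_tree_Un[OF assms(2)])
qed

lemma prob_half_tree_eq_0:
  assumes "u \<in> V" "w \<in> farther_nbrs u v" "\<And>x. x \<in> set_pmf \<rho> \<Longrightarrow> \<delta> u x < \<delta> u w"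
  shows "measure_pmf.prob \<rho> (half_tree w v) = 0"
  using graph_dist_half_tree[OF assms(1,2)] assms(3) by (fastforce simp: measure_pmf_zero_iff)

lemma sum_prob_half_tree:
  assumes "set_pmf \<rho> \<subseteq> V" "v \<in> V" "finite (nbrs v)"
  shows "(\<Sum>w\<in>nbrs v. measure_pmf.prob \<rho> (half_tree w v)) = 1 - pmf \<rho> v"
proof -
  have "(\<Sum>w\<in>nbrs v. measure_pmf.prob \<rho> (half_tree w v)) =
      measure_pmf.prob \<rho> (\<Union>w\<in>nbrs v. half_tree w v)"
    using assms(3) half_trees_at_vertex_disjoint
    by (intro measure_pmf.finite_measure_finite_Union[symmetric]) (auto simp: disjoint_family_on_def)
  also have "\<dots> = measure_pmf.prob \<rho> V - measure_pmf.prob \<rho> {v}"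
    unfolding UN_half_tree[OF assms(2)] using assms(2) by (intro measure_pmf.finite_measure_Diff) auto
  also have "measure_pmf.prob \<rho> V = 1"
    using assms(1) by (auto simp: measure_pmf.prob_eq_1 AE_measure_pmf_iff)
  finally show ?thesis by (simp add: measure_pmf_single)
qed

end

locale locally_finite_tree = pair_tree +
  assumes finite_nbrs: "v \<in> V \<Longrightarrow> finite (nbrs v)"
begin

lemma finite_farther_nbrs: "v \<in> V \<Longrightarrow> finite (farther_nbrs u v)"
  by (rule finite_subset[OF _ finite_nbrs]) (auto simp: farther_nbrs_def)

lemma prob_half_tree_rec:
  assumes "u \<in> V" "set_pmf \<rho> \<subseteq> V" "w \<in> farther_nbrs u v"
  shows "measure_pmf.prob \<rho> (half_tree w v) =
    pmf \<rho> w + (\<Sum>x\<in>farther_nbrs u w. measure_pmf.prob \<rho> (half_tree x w))"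
proof -
  have "adj v w" "w \<in> V" using assms(3) by (auto simp: farther_nbrs_def dest: in_arcsD2)
  have "nearer_nbrs u w = {v}"
    using assms(3) nearer_nbr_unique[OF assms(1)] by (auto simp: farther_nbrs_iff_nearer_nbrs)
  then have "nbrs w = insert v (farther_nbrs u w)" "v \<notin> farther_nbrs u w"
    using nbrs_eq_nearer_Un_farther[OF assms(1), of w] nearer_farther_nbrs_disjoint[of u w] by blast+
  then have "(\<Sum>x\<in>nbrs w. measure_pmf.prob \<rho> (half_tree x w)) =
      measure_pmf.prob \<rho> (half_tree v w) + (\<Sum>x\<in>farther_nbrs u w. measure_pmf.prob \<rho> (half_tree x w))"
    using finite_farther_nbrs[OF \<open>w \<in> V\<close>] by simp
  then show ?thesis
    using sum_prob_half_tree[OF assms(2) \<open>w \<in> V\<close> finite_nbrs[OF \<open>w \<in> V\<close>]]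
      prob_half_tree_swap[OF assms(2) \<open>adj v w\<close>] by simp
qed

section \<open>Optimal transport on trees\<close>

definition net_flow :: "'a pmf \<Rightarrow> 'a pmf \<Rightarrow> 'a \<Rightarrow> 'a \<Rightarrow> real" where
  "net_flow \<rho> \<sigma> v w = measure_pmf.prob \<rho> (half_tree v w) - measure_pmf.prob \<sigma> (half_tree v w)"

lemma net_flow_swap:
  assumes "set_pmf \<rho> \<subseteq> V" "set_pmf \<sigma> \<subseteq> V" "adj v w"
  shows "net_flow \<rho> \<sigma> w v = - net_flow \<rho> \<sigma> v w"
  using prob_half_tree_swap[OF assms(1,3)] prob_half_tree_swap[OF assms(2,3)] by (simp add: net_flow_def)

lemma sum_net_flow:
  assumes "set_pmf \<rho> \<subseteq> V" "set_pmf \<sigma> \<subseteq> V" "v \<in> V"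
  shows "(\<Sum>w\<in>nbrs v. net_flow \<rho> \<sigma> v w) = pmf \<rho> v - pmf \<sigma> v"
proof -
  have "(\<Sum>w\<in>nbrs v. net_flow \<rho> \<sigma> v w) = - (\<Sum>w\<in>nbrs v. net_flow \<rho> \<sigma> w v)"
    using net_flow_swap[OF assms(1,2), of v] by (simp flip: sum_negf)
  also have "(\<Sum>w\<in>nbrs v. net_flow \<rho> \<sigma> w v) = (1 - pmf \<rho> v) - (1 - pmf \<sigma> v)"
    using sum_prob_half_tree[OF assms(1,3)] sum_prob_half_tree[OF assms(2,3)] finite_nbrs[OF assms(3)]
    by (simp add: net_flow_def sum_subtractf)
  finally show ?thesis by simp
qed

lemma net_flow_finite_support:
  assumes "finite (set_pmf \<rho>)" "finite (set_pmf \<sigma>)" "set_pmf \<rho> \<subseteq> V" "set_pmf \<sigma> \<subseteq> V"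
  obtains B where "finite B"
    and "\<And>v w. adj v w \<Longrightarrow> net_flow \<rho> \<sigma> v w \<noteq> 0 \<Longrightarrow> v \<in> B \<and> w \<in> B"
proof -
  obtain u where centre: "u \<in> V" using set_pmf_not_empty[of \<rho>] assms(3) by blast
  define r where "r = Max (\<delta> u ` (set_pmf \<rho> \<union> set_pmf \<sigma>))"
  define B where "B = {v \<in> V. \<delta> u v \<le> r}"
  have support: "\<delta> u x \<le> r" if "x \<in> set_pmf \<rho> \<union> set_pmf \<sigma>" for x
    unfolding r_def by (rule Max_ge) (use that assms(1,2) in auto)
  have ends: "v \<in> B \<and> w \<in> B" if "w \<in> farther_nbrs u v" "net_flow \<rho> \<sigma> w v \<noteq> 0" for v w
  proof -
    have "\<delta> u w \<le> r"
    proof (rule ccontr)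
      assume "\<not> \<delta> u w \<le> r"
      then have "\<delta> u x < \<delta> u w" if "x \<in> set_pmf \<rho> \<union> set_pmf \<sigma>" for x using support[OF that] by simp
      then show False
        using that prob_half_tree_eq_0[OF centre that(1), of \<rho>] prob_half_tree_eq_0[OF centre that(1), of \<sigma>]
        by (simp add: net_flow_def)
    qed
    with that(1) show ?thesis by (auto simp: B_def farther_nbrs_def dest: in_arcsD1 in_arcsD2)
  qed
  have "v \<in> B \<and> w \<in> B" if "adj v w" "net_flow \<rho> \<sigma> v w \<noteq> 0" for v w
  proof -
    have "w \<in> nbrs v" using that(1) by simp
    then consider "w \<in> farther_nbrs u v" | "v \<in> farther_nbrs u w"
      using nbrs_eq_nearer_Un_farther[OF centre] farther_nbrs_iff_nearer_nbrs by blast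
    then show ?thesis using ends net_flow_swap[OF assms(3,4) that(1)] that(2) by cases auto
  qed
  moreover have "finite B"
    unfolding B_def by (rule finite_ball_of_finite_nbrs[OF finite_nbrs centre])
  ultimately show thesis by (rule that[rotated])
qed

definition forward_flow :: "'a pmf \<Rightarrow> 'a pmf \<Rightarrow> 'a \<Rightarrow> 'a \<Rightarrow> real" where
  "forward_flow \<rho> \<sigma> v w = (if adj v w then max 0 (net_flow \<rho> \<sigma> v w) else 0)"

lemma flow_on_forward_flow:
  assumes "finite (set_pmf \<rho>)" "finite (set_pmf \<sigma>)" "set_pmf \<rho> \<subseteq> V" "set_pmf \<sigma> \<subseteq> V"
    and along: "\<And>v w. adj v w \<Longrightarrow> 0 < net_flow \<rho> \<sigma> v w \<Longrightarrow> R v w"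
  obtains B where "flow_on B R (forward_flow \<rho> \<sigma>) \<rho> \<sigma>"
proof -
  obtain B where finite: "finite B"
    and carried: "\<And>v w. adj v w \<Longrightarrow> net_flow \<rho> \<sigma> v w \<noteq> 0 \<Longrightarrow> v \<in> B \<and> w \<in> B"
    using net_flow_finite_support[OF assms(1-4)] by blast
  have "pmf \<rho> v - pmf \<sigma> v = (\<Sum>w\<in>B. forward_flow \<rho> \<sigma> v w) - (\<Sum>w\<in>B. forward_flow \<rho> \<sigma> w v)" for v
  proof (cases "v \<in> V")
    case True
    have "forward_flow \<rho> \<sigma> v w - forward_flow \<rho> \<sigma> w v = (if w \<in> nbrs v then net_flow \<rho> \<sigma> v w else 0)" for w
      using net_flow_swap[OF assms(3,4), of v w] arcs_symmetric[of v w] arcs_symmetric[of w v]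
      by (auto simp: forward_flow_def)
    then have "(\<Sum>w\<in>B. forward_flow \<rho> \<sigma> v w) - (\<Sum>w\<in>B. forward_flow \<rho> \<sigma> w v) = (\<Sum>w\<in>B \<inter> nbrs v. net_flow \<rho> \<sigma> v w)"
      by (simp only: sum_subtractf[symmetric] sum.inter_restrict[OF finite])
    also have "\<dots> = (\<Sum>w\<in>nbrs v. net_flow \<rho> \<sigma> v w)"
      by (rule sum.mono_neutral_left) (use carried finite_nbrs[OF True] in auto)
    finally show ?thesis using sum_net_flow[OF assms(3,4) True] by simp
  next
    case False
    then have "pmf \<rho> v = 0" "pmf \<sigma> v = 0" using assms(3,4) by (auto simp: pmf_eq_0_set_pmf)
    moreover have "\<not> adj v w" "\<not> adj w v" for w using False in_arcsD1 in_arcsD2 by auto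
    ultimately show ?thesis by (simp add: forward_flow_def)
  qed
  moreover have "v \<in> B \<and> w \<in> B \<and> R v w" if "forward_flow \<rho> \<sigma> v w \<noteq> 0" for v w
    using that carried[of v w] along[of v w] by (auto simp: forward_flow_def split: if_splits)
  moreover have "0 \<le> forward_flow \<rho> \<sigma> v w" for v w by (simp add: forward_flow_def)
  ultimately have "flow_on B R (forward_flow \<rho> \<sigma>) \<rho> \<sigma>" using finite by (simp add: flow_on_def)
  then show thesis by (rule that)
qed

lemma W1_eq_potential_diff:
  assumes measures: "finite (set_pmf \<rho>)" "finite (set_pmf \<sigma>)" "set_pmf \<rho> \<subseteq> V" "set_pmf \<sigma> \<subseteq> V"
    and lipschitz: "\<And>v w. adj v w \<Longrightarrow> f v - f w \<le> 1"
    and descent: "\<And>v w. adj v w \<Longrightarrow> 0 < net_flow \<rho> \<sigma> v w \<Longrightarrow> f v = f w + 1"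
  shows "W1 G \<rho> \<sigma> = measure_pmf.expectation \<rho> f - measure_pmf.expectation \<sigma> f"
proof (rule W1_eq_expectation_diff)
  show "f v - f w \<le> real (\<delta> v w)" if "v \<in> set_pmf \<rho>" "w \<in> set_pmf \<sigma>" for v w
    using that measures by (intro lipschitz_of_adj lipschitz) auto
  let ?R = "\<lambda>v w. adj v w \<and> f v = f w + 1"
  obtain B where "flow_on B ?R (forward_flow \<rho> \<sigma>) \<rho> \<sigma>"
    by (rule flow_on_forward_flow[OF measures, of ?R]) (use descent in blast)+
  then have "rel_pmf ?R\<^sup>*\<^sup>* \<rho> \<sigma>" by (rule flow_on_imp_rel_pmf[where f = f]) simp
  then show "rel_pmf (\<lambda>v w. real (\<delta> v w) \<le> f v - f w) \<rho> \<sigma>"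
    by (rule pmf.rel_mono_strong) (use measures(3) graph_dist_le_descent[of f] in blast)
qed (fact measures)+

end

section \<open>Radial measures on regular trees\<close>

locale regular_pair_tree = pair_tree +
  fixes q :: nat
  assumes finite_card_nbrs: "v \<in> V \<Longrightarrow> finite (nbrs v) \<and> card (nbrs v) = q + 1"
    and q_pos: "0 < q"
begin

sublocale locally_finite_tree
  using finite_card_nbrs by unfold_locales simp

lemma card_farther_nbrs:
  assumes "u \<in> V" "v \<in> V"
  shows "card (farther_nbrs u v) = (if u = v then q + 1 else q)"
proof -
  have "card (nbrs v) = card (nearer_nbrs u v) + card (farther_nbrs u v)"
    unfolding nbrs_eq_nearer_Un_farther[OF assms(1)]
    by (intro card_Un_disjoint nearer_farther_nbrs_disjoint finite_nearer_nbrs finite_farther_nbrs assms)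
  then show ?thesis
    using finite_card_nbrs[OF assms(2)] card_nearer_nbrs[OF assms] by (auto split: if_splits)
qed

lemma vertex_at_graph_dist_exists:
  assumes "u \<in> V"
  shows "\<exists>v\<in>V. \<delta> u v = m"
proof (induction m)
  case 0
  show ?case using assms graph_dist_self by blast
next
  case (Suc m)
  then obtain v where at_m: "v \<in> V" "\<delta> u v = m" by blast
  then have "farther_nbrs u v \<noteq> {}" using card_farther_nbrs[OF assms, of v] q_pos by (force split: if_splits)
  with at_m show ?case by (auto simp: farther_nbrs_def dest: in_arcsD2)
qed

definition radial :: "(nat \<Rightarrow> real) \<Rightarrow> 'a \<Rightarrow> 'a pmf \<Rightarrow> bool" where
  "radial g u \<rho> \<longleftrightarrow> u \<in> V \<and> finite (set_pmf \<rho>) \<and> set_pmf \<rho> \<subseteq> V \<and> (\<forall>v\<in>V. pmf \<rho> v = g (\<delta> u v))"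

lemma radial_nonneg: "radial g u \<rho> \<Longrightarrow> 0 \<le> g m"
  using vertex_at_graph_dist_exists[of u m] by (metis pmf_nonneg radial_def)

lemma radial_nonzero: "radial g u \<rho> \<Longrightarrow> v \<in> set_pmf \<rho> \<Longrightarrow> g (\<delta> u v) \<noteq> 0"
  by (metis pmf_eq_0_set_pmf radial_def subsetD)

lemma radial_finite_support:
  assumes "radial g u \<rho>"
  shows "finite {m. g m \<noteq> 0}"
proof (rule finite_subset)
  show "{m. g m \<noteq> 0} \<subseteq> \<delta> u ` set_pmf \<rho>"
  proof
    fix m assume "m \<in> {m. g m \<noteq> 0}"
    moreover obtain v where "v \<in> V" "\<delta> u v = m"
      using vertex_at_graph_dist_exists assms by (metis radial_def)
    ultimately show "m \<in> \<delta> u ` set_pmf \<rho>" using assms by (auto simp: radial_def set_pmf_iff)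
  qed
qed (use assms in \<open>simp add: radial_def\<close>)

definition branch_mass :: "(nat \<Rightarrow> real) \<Rightarrow> nat \<Rightarrow> real" where
  "branch_mass g m = (\<Sum>k. real q ^ k * g (m + k))"

lemma summable_branch_mass:
  assumes "finite {m. g m \<noteq> 0}"
  shows "summable (\<lambda>k. real q ^ k * g (m + k))"
proof (rule summable_finite)
  show "finite ((\<lambda>k. m + k) -` {m. g m \<noteq> 0})" by (intro finite_vimageI assms) simp
qed simp

lemma branch_mass_rec:
  assumes "finite {m. g m \<noteq> 0}"
  shows "branch_mass g m = g m + real q * branch_mass g (Suc m)"
proof -
  have "branch_mass g m = g m + (\<Sum>k. real q * (real q ^ k * g (Suc m + k)))"
    unfolding branch_mass_def using suminf_split_head[OF summable_branch_mass[OF assms, of m]]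
    by (simp add: mult.assoc)
  then show ?thesis
    using suminf_mult[OF summable_branch_mass[OF assms, of "Suc m"], of "real q"]
    by (simp add: branch_mass_def)
qed

lemma prob_half_tree_radial:
  assumes "radial g u \<rho>" "w \<in> farther_nbrs u v"
  shows "measure_pmf.prob \<rho> (half_tree w v) = branch_mass g (\<delta> u w)"
proof -
  have centre: "u \<in> V" "set_pmf \<rho> \<subseteq> V" using assms(1) by (auto simp: radial_def)
  note finite_support = radial_finite_support[OF assms(1)]
  then obtain L where support: "{m. g m \<noteq> 0} \<subseteq> {..L}" using finite_nat_iff_bounded_le by blast
  show ?thesis
    using assms(2)
  proof (induction "Suc L - \<delta> u w" arbitrary: v w)
    case 0
    then have "L < \<delta> u w" by simp
    have "\<delta> u x \<le> L" if "x \<in> set_pmf \<rho>" for x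
      using radial_nonzero[OF assms(1) that] support by blast
    then have "measure_pmf.prob \<rho> (half_tree w v) = 0"
      using \<open>L < \<delta> u w\<close> by (intro prob_half_tree_eq_0[OF centre(1) 0(2)]) fastforce
    moreover have "g (\<delta> u w + k) = 0" for k using \<open>L < \<delta> u w\<close> support by fastforce
    then have "branch_mass g (\<delta> u w) = 0" by (simp add: branch_mass_def)
    ultimately show ?case by simp
  next
    case (Suc n)
    have off_centre: "w \<in> V" "u \<noteq> w" using Suc.prems centre(1) by (auto simp: farther_nbrs_def dest: in_arcsD2)
    have "measure_pmf.prob \<rho> (half_tree x w) = branch_mass g (Suc (\<delta> u w))"
      if "x \<in> farther_nbrs u w" for x
    proof -
      have "\<delta> u x = Suc (\<delta> u w)" using that by (simp add: farther_nbrs_def)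
      then show ?thesis using Suc.hyps(1)[OF _ that] Suc.hyps(2) by simp
    qed
    then have "measure_pmf.prob \<rho> (half_tree w v) = g (\<delta> u w) + real q * branch_mass g (Suc (\<delta> u w))"
      using assms(1) off_centre card_farther_nbrs[OF centre(1) off_centre(1)]
      by (simp add: prob_half_tree_rec[OF centre Suc.prems] radial_def)
    then show ?case by (simp only: branch_mass_rec[OF finite_support, of "\<delta> u w"])
  qed
qed

lemma prob_half_tree_radial_compl:
  assumes "radial g u \<rho>" "w \<in> farther_nbrs u v"
  shows "measure_pmf.prob \<rho> (half_tree v w) = 1 - branch_mass g (\<delta> u w)"
proof -
  have "adj w v" "set_pmf \<rho> \<subseteq> V"
    using assms by (auto simp: radial_def farther_nbrs_def arcs_symmetric)
  then show ?thesis using prob_half_tree_swap prob_half_tree_radial[OF assms] by simp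
qed

context
  fixes g :: "nat \<Rightarrow> real" and u :: 'a and \<rho> :: "'a pmf"
  assumes radial: "radial g u \<rho>"
begin

lemma branch_mass_nonneg: "0 \<le> branch_mass g m"
  unfolding branch_mass_def
  by (intro suminf_nonneg summable_branch_mass radial_finite_support[OF radial] mult_nonneg_nonneg
      radial_nonneg[OF radial]) simp

lemma antimono_branch_mass: "antimono (branch_mass g)"
proof (rule decseq_SucI)
  fix m
  have "1 * branch_mass g (Suc m) \<le> real q * branch_mass g (Suc m)"
    by (intro mult_right_mono branch_mass_nonneg) (use q_pos in simp)
  then show "branch_mass g (Suc m) \<le> branch_mass g m"
    using branch_mass_rec[OF radial_finite_support[OF radial], of m] radial_nonneg[OF radial, of m]
    by simp
qed

lemma branch_mass_total: "g 0 + real (q + 1) * branch_mass g 1 = 1"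
proof -
  have centre: "u \<in> V" "set_pmf \<rho> \<subseteq> V" "pmf \<rho> u = g 0" using radial by (auto simp: radial_def)
  have all_farther: "nbrs u = farther_nbrs u u" using nbrs_eq_nearer_Un_farther[OF centre(1), of u] centre(1) by simp
  have "measure_pmf.prob \<rho> (half_tree w u) = branch_mass g 1" if "adj u w" for w
    using prob_half_tree_radial[OF radial, of w u] graph_dist_adj[OF that] that all_farther by auto
  then show ?thesis
    using sum_prob_half_tree[OF centre(2,1) finite_nbrs[OF centre(1)]] finite_card_nbrs[OF centre(1)] centre(3) by simp
qed

lemma branch_mass_le_half: "branch_mass g (Suc m) \<le> 1 / 2"
proof -
  have "2 * branch_mass g 1 \<le> real (q + 1) * branch_mass g 1"
    by (intro mult_right_mono branch_mass_nonneg) (use q_pos in simp)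
  then have "branch_mass g 1 \<le> 1 / 2" using branch_mass_total radial_nonneg[OF radial, of 0] by simp
  then show ?thesis using antimonoD[OF antimono_branch_mass, of 1 "Suc m"] by simp
qed

end

end

lemma regular_pair_treeI:
  assumes "regular_tree (q + 1) G" "0 < q"
  shows "regular_pair_tree G q"
proof -
  interpret pair_bidirected_digraph G using assms(1) by (simp add: regular_tree_def)
  show ?thesis
  proof
    fix v assume "v \<in> pverts G"
    moreover have "out_arcs (with_proj G) v = Pair v ` {w. (v, w) \<in> parcs G}"
      by (auto simp: out_arcs_def)
    moreover have "inj_on (Pair v) {w. (v, w) \<in> parcs G}" by (auto simp: inj_on_def)
    ultimately show "finite {w. (v, w) \<in> parcs G} \<and> card {w. (v, w) \<in> parcs G} = q + 1"
      using assms(1) by (auto simp: regular_tree_def out_degree_def finite_image_iff card_image)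
  qed (use assms in \<open>auto simp: regular_tree_def not_le\<close>)
qed

section \<open>Layers over a geodesic\<close>

context pair_tree begin

lemma even_graph_dist_perimeter:
  assumes "x \<in> V" "y \<in> V" "v \<in> V"
  shows "even (\<delta> x v + \<delta> y v + \<delta> x y)"
  using assms(1,3)
proof (induction rule: graph_dist_induct)
  case base
  then show ?case using assms graph_dist_commute[of x y] by simp
next
  case (step v w)
  then have "adj v w" "\<delta> x v = Suc (\<delta> x w)" by (auto simp: nearer_nbrs_def)
  then show ?case using step.IH by (cases rule: adj_cases[OF assms(2) \<open>adj v w\<close>]) auto
qed

lemma geodesic_point_unique:
  assumes "x \<in> V" "y \<in> V" "v \<in> V" "w \<in> V" "\<delta> x v = \<delta> x w"
    and "\<delta> x v + \<delta> y v = \<delta> x y" "\<delta> x w + \<delta> y w = \<delta> x y"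
  shows "v = w"
  using assms(1,3-7)
proof (induction arbitrary: w rule: graph_dist_induct)
  case base
  then show ?case using assms(1) graph_dist_eq_0_iff by simp
next
  case (step v v')
  have predecessor: "\<delta> y u' = Suc (\<delta> y u) \<and> u' \<in> V"
    if "u' \<in> nearer_nbrs x u" "\<delta> x u + \<delta> y u = \<delta> x y" for u u'
    using that graph_dist_adj_le[OF assms(2), of u u'] graph_dist_le_add[OF assms(1,2), of u']
    by (auto simp: nearer_nbrs_def dest: in_arcsD2)
  have "\<delta> x w \<noteq> 0" using step.hyps step.prems(2) by (simp add: nearer_nbrs_def)
  then have "x \<noteq> w" using assms(1) by auto
  then obtain w' where nearer: "w' \<in> nearer_nbrs x w"
    using nearer_nbrs_nonempty[OF assms(1) step.prems(1)] by blast
  note v'_dist = predecessor[OF step.hyps(2) step.prems(3)] and w'_dist = predecessor[OF nearer step.prems(4)]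
  have "v' = w'"
  proof (rule step.IH)
    show "\<delta> x v' = \<delta> x w'" "\<delta> x v' + \<delta> y v' = \<delta> x y" "\<delta> x w' + \<delta> y w' = \<delta> x y"
      using step.hyps(2) step.prems nearer v'_dist w'_dist by (auto simp: nearer_nbrs_def)
  qed (use w'_dist in blast)
  then have "v \<in> nearer_nbrs y v'" "w \<in> nearer_nbrs y v'"
    using step.hyps(2) nearer v'_dist w'_dist by (auto simp: nearer_nbrs_def arcs_symmetric)
  then show ?case by (rule nearer_nbr_unique[OF assms(2)])
qed

lemma nearer_nbrs_eq_off_geodesic:
  assumes "x \<in> V" "y \<in> V" "\<delta> x v + \<delta> y v \<noteq> \<delta> x y"
  shows "nearer_nbrs x v = nearer_nbrs y v"
proof -
  have "nearer_nbrs x v \<subseteq> nearer_nbrs y v"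
    if off: "x \<in> V" "y \<in> V" "\<delta> x v + \<delta> y v \<noteq> \<delta> x y" for x y
  proof
    fix w assume nearer: "w \<in> nearer_nbrs x v"
    then have "w \<notin> farther_nbrs y v"
      using graph_dist_eq_add[OF off(2,1), of w v] off graph_dist_commute[OF off(1,2)] by auto
    moreover have "w \<in> nbrs v" using nearer by (simp add: nearer_nbrs_def)
    ultimately show "w \<in> nearer_nbrs y v" using nbrs_eq_nearer_Un_farther[OF off(2)] by blast
  qed
  from this[OF assms] this[OF assms(2,1)] show ?thesis
    using assms(3) graph_dist_commute[OF assms(1,2)] by auto
qed

end

locale pair_tree_two_points = pair_tree +
  fixes X Y :: 'a
  assumes X: "X \<in> V" and Y: "Y \<in> V" and X_neq_Y: "X \<noteq> Y"
begin

abbreviation d :: nat where "d \<equiv> \<delta> X Y"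

lemma d_pos: "0 < d"
  using graph_dist_eq_0_iff[OF X Y] X_neq_Y by simp

text \<open>
  The vertices whose nearest point on the geodesic from \<open>X\<close> to \<open>Y\<close> is its \<open>i\<close>-th vertex, at
  distance \<open>h\<close>.
\<close>

definition layer :: "nat \<Rightarrow> nat \<Rightarrow> 'a set" where
  "layer i h = {v \<in> V. \<delta> X v = i + h \<and> \<delta> Y v = d - i + h}"

lemma layer_exists:
  assumes "v \<in> V"
  obtains i h where "i \<le> d" "v \<in> layer i h"
proof -
  obtain k where "\<delta> X v + \<delta> Y v + d = 2 * k"
    using even_graph_dist_perimeter[OF X Y assms] by (rule evenE)
  moreover have "d \<le> \<delta> X v + \<delta> Y v" by (rule graph_dist_le_add[OF X Y assms])
  moreover have "\<delta> Y v \<le> d + \<delta> X v" "\<delta> X v \<le> d + \<delta> Y v"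
    using graph_dist_triangle[OF Y X assms] graph_dist_triangle[OF X Y assms] graph_dist_commute[OF X Y]
    by simp_all
  ultimately have "k - \<delta> Y v \<le> d" "v \<in> layer (k - \<delta> Y v) (k - d)"
    using assms by (auto simp: layer_def)
  then show thesis by (rule that)
qed

lemma layer_unique:
  assumes "i \<le> d" "j \<le> d" "v \<in> layer i h" "v \<in> layer j k"
  shows "i = j \<and> h = k"
  using assms by (auto simp: layer_def)

lemma card_layer_0:
  assumes "i \<le> d"
  shows "card (layer i 0) = 1"
proof -
  obtain v where point: "v \<in> layer i 0"
    using geodesic_point_exists[OF X Y assms] by (auto simp: layer_def)
  then have "layer i 0 = {v}"
    using geodesic_point_unique[OF X Y] assms by (auto simp: layer_def)
  then show ?thesis by simp
qed

lemma layer_Suc: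
  assumes "i \<le> d"
  shows "layer i (Suc h) = (\<Union>v\<in>layer i h. farther_nbrs X v \<inter> farther_nbrs Y v)"
proof (intro equalityI subsetI)
  fix w assume above: "w \<in> layer i (Suc h)"
  then have "X \<noteq> w" using X by (auto simp: layer_def)
  then obtain v where "v \<in> nearer_nbrs X w"
    using nearer_nbrs_nonempty[OF X, of w] above by (auto simp: layer_def)
  moreover from this have "v \<in> nearer_nbrs Y w"
    using nearer_nbrs_eq_off_geodesic[OF X Y, of w] above assms by (auto simp: layer_def)
  ultimately show "w \<in> (\<Union>v\<in>layer i h. farther_nbrs X v \<inter> farther_nbrs Y v)"
    using above by (auto simp: farther_nbrs_iff_nearer_nbrs layer_def nearer_nbrs_def dest: in_arcsD2)
qed (auto simp: layer_def farther_nbrs_def dest: in_arcsD2)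

lemma card_nearer_nbrs_Un:
  assumes "i \<le> d" "v \<in> layer i h"
  shows "card (nearer_nbrs X v \<union> nearer_nbrs Y v) = (if h = 0 \<and> 0 < i \<and> i < d then 2 else 1)"
proof -
  have dists: "v \<in> V" "\<delta> X v = i + h" "\<delta> Y v = d - i + h" using assms(2) by (auto simp: layer_def)
  show ?thesis
  proof (cases "h = 0")
    case True
    then have "nearer_nbrs X v \<inter> nearer_nbrs Y v = {}"
      using dists assms(1) by (intro nearer_nbrs_disjoint_on_geodesic[OF X Y]) simp
    then have "card (nearer_nbrs X v \<union> nearer_nbrs Y v) = card (nearer_nbrs X v) + card (nearer_nbrs Y v)"
      by (intro card_Un_disjoint finite_nearer_nbrs X Y)
    moreover have "X = v \<longleftrightarrow> i = 0" "Y = v \<longleftrightarrow> i = d"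
      using graph_dist_eq_0_iff[OF X dists(1)] graph_dist_eq_0_iff[OF Y dists(1)] dists True assms(1) by auto
    ultimately show ?thesis
      using card_nearer_nbrs[OF X dists(1)] card_nearer_nbrs[OF Y dists(1)] True assms(1) d_pos by auto
  next
    case False
    then have "nearer_nbrs X v = nearer_nbrs Y v" "X \<noteq> v"
      using dists assms(1) X by (auto intro!: nearer_nbrs_eq_off_geodesic[OF X Y])
    then show ?thesis using card_nearer_nbrs[OF X dists(1)] False by simp
  qed
qed

definition layers_upto :: "nat \<Rightarrow> 'a set" where
  "layers_upto H = (\<Union>i\<le>d. \<Union>h\<le>H. layer i h)"

lemma layers_upto_subset: "layers_upto H \<subseteq> V"
  by (auto simp: layers_upto_def layer_def)

lemma in_layers_upto:
  assumes "v \<in> V" "\<delta> X v \<le> H \<or> \<delta> Y v \<le> H"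
  shows "v \<in> layers_upto H"
proof -
  obtain i h where in_layer: "i \<le> d" "v \<in> layer i h" using layer_exists[OF assms(1)] by blast
  then have "h \<le> H" using assms(2) by (auto simp: layer_def)
  with in_layer show ?thesis by (auto simp: layers_upto_def)
qed

end

locale regular_pair_tree_two_points = regular_pair_tree + pair_tree_two_points
begin

lemma card_farther_nbrs_Int:
  assumes "i \<le> d" "v \<in> layer i h"
  shows "card (farther_nbrs X v \<inter> farther_nbrs Y v) = (if h = 0 \<and> 0 < i \<and> i < d then q - 1 else q)"
proof -
  have "v \<in> V" using assms(2) by (simp add: layer_def)
  have "nbrs v = (nearer_nbrs X v \<union> nearer_nbrs Y v) \<union> (farther_nbrs X v \<inter> farther_nbrs Y v)"
    using nbrs_eq_nearer_Un_farther[OF X, of v] nbrs_eq_nearer_Un_farther[OF Y, of v] by blast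
  moreover have "(nearer_nbrs X v \<union> nearer_nbrs Y v) \<inter> (farther_nbrs X v \<inter> farther_nbrs Y v) = {}"
    using nearer_farther_nbrs_disjoint by blast
  ultimately have "card (nearer_nbrs X v \<union> nearer_nbrs Y v) +
      card (farther_nbrs X v \<inter> farther_nbrs Y v) = q + 1"
    using finite_card_nbrs[OF \<open>v \<in> V\<close>] finite_nearer_nbrs X Y finite_farther_nbrs[OF \<open>v \<in> V\<close>]
    by (metis card_Un_disjoint finite_Int finite_UnI)
  then show ?thesis
    using card_nearer_nbrs_Un[OF assms] by (cases "h = 0 \<and> 0 < i \<and> i < d") auto
qed

definition layer_card :: "nat \<Rightarrow> nat \<Rightarrow> nat" where
  "layer_card i h = (if i = 0 \<or> i = d then q ^ h else if h = 0 then 1 else (q - 1) * q ^ (h - 1))"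

lemma finite_layer_and_card:
  assumes "i \<le> d"
  shows "finite (layer i h) \<and> card (layer i h) = layer_card i h"
proof (induction h)
  case 0
  then show ?case using card_layer_0[OF assms] card_gt_0_iff[of "layer i 0"] by (simp add: layer_card_def)
next
  case (Suc h)
  have "finite (farther_nbrs X v \<inter> farther_nbrs Y v)" if "v \<in> layer i h" for v
    using that finite_farther_nbrs by (auto simp: layer_def)
  moreover have "(farther_nbrs X v \<inter> farther_nbrs Y v) \<inter> (farther_nbrs X w \<inter> farther_nbrs Y w) = {}"
    if "v \<noteq> w" for v w
    using that nearer_nbr_unique[OF X] by (auto simp: farther_nbrs_iff_nearer_nbrs)
  ultimately have "card (layer i (Suc h)) = (\<Sum>v\<in>layer i h. card (farther_nbrs X v \<inter> farther_nbrs Y v))"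
    and "finite (layer i (Suc h))"
    unfolding layer_Suc[OF assms] using Suc by (auto intro!: card_UN_disjoint)
  moreover have "layer_card i h * (if h = 0 \<and> 0 < i \<and> i < d then q - 1 else q) = layer_card i (Suc h)"
    using assms by (cases h) (auto simp: layer_card_def)
  ultimately show ?case
    using Suc card_farther_nbrs_Int[OF assms] by (simp del: if_split)
qed

lemmas finite_layer = finite_layer_and_card[THEN conjunct1]
  and card_layer = finite_layer_and_card[THEN conjunct2]

lemma finite_layers_upto: "finite (layers_upto H)"
  by (auto simp: layers_upto_def intro!: finite_layer)

lemma sum_layers_upto:
  fixes F :: "nat \<Rightarrow> nat \<Rightarrow> real"
  shows "(\<Sum>v\<in>layers_upto H. F (\<delta> X v) (\<delta> Y v)) =
    (\<Sum>i\<le>d. \<Sum>h\<le>H. real (layer_card i h) * F (i + h) (d - i + h))"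
proof -
  have "(\<Sum>v\<in>layers_upto H. F (\<delta> X v) (\<delta> Y v)) =
      (\<Sum>i\<le>d. \<Sum>v\<in>(\<Union>h\<le>H. layer i h). F (\<delta> X v) (\<delta> Y v))"
    unfolding layers_upto_def
    by (rule sum.UNION_disjoint) (auto simp: finite_layer dest: layer_unique)
  also have "\<dots> = (\<Sum>i\<le>d. \<Sum>h\<le>H. \<Sum>v\<in>layer i h. F (\<delta> X v) (\<delta> Y v))"
    by (intro sum.cong refl sum.UNION_disjoint) (auto simp: finite_layer dest: layer_unique)
  also have "\<dots> = (\<Sum>i\<le>d. \<Sum>h\<le>H. \<Sum>v\<in>layer i h. F (i + h) (d - i + h))"
    by (intro sum.cong refl) (auto simp: layer_def)
  also have "\<dots> = (\<Sum>i\<le>d. \<Sum>h\<le>H. real (layer_card i h) * F (i + h) (d - i + h))"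
    by (intro sum.cong refl) (simp add: card_layer)
  finally show ?thesis .
qed

end

section \<open>The Kantorovich potential\<close>

context pair_tree_two_points begin

text \<open>
  As a function of the distances \<open>a\<close> and \<open>b\<close> to \<open>X\<close> and \<open>Y\<close>: the signed distance to the midpoint of
  the geodesic, but \<open>0\<close> on all branches off it at a midpoint vertex.
\<close>

definition potential_at :: "nat \<Rightarrow> nat \<Rightarrow> real" where
  "potential_at a b = (if a < b then real b - real d / 2 else if b < a then real d / 2 - real a else 0)"

abbreviation potential :: "'a \<Rightarrow> real" where
  "potential v \<equiv> potential_at (\<delta> X v) (\<delta> Y v)"

lemma adj_two_points_cases [consumes 1, case_names outward inward to_Y to_X]:
  assumes "adj v w"
  obtains "w \<in> farther_nbrs X v" "w \<in> farther_nbrs Y v"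
    | "v \<in> farther_nbrs X w" "v \<in> farther_nbrs Y w"
    | "w \<in> farther_nbrs X v" "v \<in> farther_nbrs Y w" "\<delta> X v + \<delta> Y v = d"
    | "v \<in> farther_nbrs X w" "w \<in> farther_nbrs Y v" "\<delta> X w + \<delta> Y w = d"
proof -
  have "w \<in> farther_nbrs u v \<or> v \<in> farther_nbrs u w" if "u \<in> V" for u
    using assms nbrs_eq_nearer_Un_farther[OF that] farther_nbrs_iff_nearer_nbrs by blast
  then show thesis
    using that X Y graph_dist_eq_add[OF X Y] farther_nbrs_iff_nearer_nbrs by metis
qed

lemma potential_adj: "adj v w \<Longrightarrow> potential v - potential w \<le> 1"
  by (cases rule: adj_two_points_cases[of v w]) (auto simp: potential_at_def farther_nbrs_def)

end

context regular_pair_tree_two_points begin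

context
  fixes g :: "nat \<Rightarrow> real" and \<rho> \<sigma> :: "'a pmf"
  assumes radial_X: "radial g X \<rho>" and radial_Y: "radial g Y \<sigma>"
begin

lemmas prob_half_tree_X = prob_half_tree_radial[OF radial_X] prob_half_tree_radial_compl[OF radial_X]
lemmas prob_half_tree_Y = prob_half_tree_radial[OF radial_Y] prob_half_tree_radial_compl[OF radial_Y]

lemma branch_mass_less_imp: "branch_mass g m < branch_mass g n \<Longrightarrow> n < m"
  using antimonoD[OF antimono_branch_mass[OF radial_X], of m n] by linarith

lemma potential_descent:
  assumes "adj v w" "0 < net_flow \<rho> \<sigma> v w"
  shows "potential v = potential w + 1"
  using assms(1)
proof (cases rule: adj_two_points_cases)
  case outward
  then have "branch_mass g (\<delta> X w) < branch_mass g (\<delta> Y w)"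
    using assms(2) by (simp add: net_flow_def prob_half_tree_X prob_half_tree_Y)
  then have "\<delta> Y w < \<delta> X w" by (rule branch_mass_less_imp)
  then show ?thesis using outward by (simp add: potential_at_def farther_nbrs_def)
next
  case inward
  then have "branch_mass g (\<delta> Y v) < branch_mass g (\<delta> X v)"
    using assms(2) by (simp add: net_flow_def prob_half_tree_X prob_half_tree_Y)
  then have "\<delta> X v < \<delta> Y v" by (rule branch_mass_less_imp)
  then show ?thesis using inward by (simp add: potential_at_def farther_nbrs_def)
next
  case to_Y
  then show ?thesis by (auto simp: potential_at_def farther_nbrs_def)
next
  case to_X
  then have "1 < branch_mass g (\<delta> X v) + branch_mass g (\<delta> Y w)"
    using assms(2) by (simp add: net_flow_def prob_half_tree_X prob_half_tree_Y)
  moreover have "\<delta> X v = Suc (\<delta> X w)" "\<delta> Y w = Suc (\<delta> Y v)" using to_X by (simp_all add: farther_nbrs_def)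
  ultimately show ?thesis
    using branch_mass_le_half[OF radial_X, of "\<delta> X w"] branch_mass_le_half[OF radial_X, of "\<delta> Y v"] by simp
qed

lemma set_pmf_subset_layers_upto:
  assumes "{m. g m \<noteq> 0} \<subseteq> {..H}"
  shows "set_pmf \<rho> \<subseteq> layers_upto H" "set_pmf \<sigma> \<subseteq> layers_upto H"
proof -
  have "\<delta> X v \<le> H" if "v \<in> set_pmf \<rho>" for v using radial_nonzero[OF radial_X that] assms by blast
  moreover have "\<delta> Y v \<le> H" if "v \<in> set_pmf \<sigma>" for v using radial_nonzero[OF radial_Y that] assms by blast
  ultimately show "set_pmf \<rho> \<subseteq> layers_upto H" "set_pmf \<sigma> \<subseteq> layers_upto H"
    using in_layers_upto radial_X radial_Y by (auto simp: radial_def subset_iff)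
qed

lemma W1_eq_sum_layers:
  assumes "{m. g m \<noteq> 0} \<subseteq> {..H}"
  shows "W1 G \<rho> \<sigma> = (\<Sum>i\<le>d. \<Sum>h\<le>H.
    real (layer_card i h) * (potential_at (i + h) (d - i + h) * (g (i + h) - g (d - i + h))))"
proof -
  have expectation: "measure_pmf.expectation \<tau> potential = (\<Sum>v\<in>layers_upto H. potential v * g (\<delta> u v))"
    if "radial g u \<tau>" "set_pmf \<tau> \<subseteq> layers_upto H" for u \<tau>
  proof -
    have "measure_pmf.expectation \<tau> potential = (\<Sum>v\<in>layers_upto H. potential v * pmf \<tau> v)"
      by (rule integral_measure_pmf_real) (use that(2) finite_layers_upto in auto)
    also have "\<dots> = (\<Sum>v\<in>layers_upto H. potential v * g (\<delta> u v))"
      using that(1) layers_upto_subset by (intro sum.cong) (auto simp: radial_def)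
    finally show ?thesis .
  qed
  have "W1 G \<rho> \<sigma> = measure_pmf.expectation \<rho> potential - measure_pmf.expectation \<sigma> potential"
    using radial_X radial_Y
    by (intro W1_eq_potential_diff potential_adj potential_descent) (auto simp: radial_def)
  also have "\<dots> = (\<Sum>v\<in>layers_upto H. potential v * (g (\<delta> X v) - g (\<delta> Y v)))"
    using set_pmf_subset_layers_upto[OF assms]
    by (simp add: expectation[OF radial_X] expectation[OF radial_Y] sum_subtractf right_diff_distrib)
  finally show ?thesis by (simp only: sum_layers_upto[of "\<lambda>a b. potential_at a b * (g a - g b)"])
qed

end

end

section \<open>The series\<close>

lemma sum_symmetric_halves:
  fixes f :: "nat \<Rightarrow> 'a::comm_semiring_1"
  assumes sym: "\<And>i. i \<le> d \<Longrightarrow> f (d - i) = f i" and mid: "\<And>i. 2 * i = d \<Longrightarrow> f i = 0"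
  shows "(\<Sum>i\<le>d. f i) = 2 * (\<Sum>i\<le>d div 2. f i)"
proof -
  have halves: "{..d} = {..d div 2} \<union> {d div 2<..d}" by auto
  have "(\<Sum>i\<le>d. f i) = (\<Sum>i\<le>d div 2. f i) + (\<Sum>i\<in>{d div 2<..d}. f i)"
    unfolding halves by (rule sum.union_disjoint) auto
  also have "(\<Sum>i\<in>{d div 2<..d}. f i) = (\<Sum>i<d - d div 2. f i)"
    by (rule sum.reindex_bij_witness[where i = "\<lambda>i. d - i" and j = "\<lambda>i. d - i"]) (auto simp: sym)
  also have "\<dots> = (\<Sum>i\<le>d div 2. f i)"
    by (rule sum.mono_neutral_left) (auto intro!: mid)
  finally show ?thesis by (simp add: mult_2)
qed

context regular_pair_tree_two_points begin

definition layer_term :: "(nat \<Rightarrow> real) \<Rightarrow> nat \<Rightarrow> nat \<Rightarrow> real" where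
  "layer_term g i h =
     real (layer_card i h) * (g (i + h) - g (d - i + h)) * (real d / 2 - real i + real h)"

lemma potential_at_layer_term:
  assumes "2 * i \<le> d"
  shows "real (layer_card i h) * (potential_at (i + h) (d - i + h) * (g (i + h) - g (d - i + h))) =
    layer_term g i h"
proof (cases "2 * i = d")
  case True
  then have "d - i = i" by simp
  then show ?thesis by (simp add: layer_term_def)
next
  case False
  then have "i + h < d - i + h" using assms by simp
  then show ?thesis using assms by (simp add: layer_term_def potential_at_def of_nat_diff)
qed

lemma layer_term_0: "layer_term g 0 h = real q ^ h * (g h - g (h + d)) * (real d / 2 + real h)"
  by (simp add: layer_term_def layer_card_def add.commute)

lemma layer_term_interior:
  assumes "0 < i" "i < d"
  shows "layer_term g i 0 = (g i - g (d - i)) * (real d / 2 - real i)"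
    and "layer_term g i (Suc h) = (real q - 1) * real q ^ h * (g (i + Suc h) - g (d - i + Suc h))
      * (real d / 2 - real i + real (Suc h))"
  using assms q_pos by (simp_all add: layer_term_def layer_card_def of_nat_diff)

lemma layer_term_eq_0:
  assumes "{m. g m \<noteq> 0} \<subseteq> {..H}" "H < h"
  shows "layer_term g i h = 0"
proof -
  have "g (i + h) = 0" "g (d - i + h) = 0" using assms by fastforce+
  then show ?thesis by (simp add: layer_term_def)
qed

lemma W1_eq_sum_layer_term:
  assumes "radial g X \<rho>" "radial g Y \<sigma>"
  shows "W1 G \<rho> \<sigma> = 2 * (\<Sum>i\<le>d div 2. \<Sum>h. layer_term g i h)"
proof -
  obtain H where support: "{m. g m \<noteq> 0} \<subseteq> {..H}"
    using radial_finite_support[OF assms(1)] finite_nat_iff_bounded_le by blast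
  let ?t = "\<lambda>i h. real (layer_card i h) * (potential_at (i + h) (d - i + h) * (g (i + h) - g (d - i + h)))"
  have "W1 G \<rho> \<sigma> = (\<Sum>i\<le>d. \<Sum>h\<le>H. ?t i h)"
    by (rule W1_eq_sum_layers[OF assms support])
  also have "\<dots> = 2 * (\<Sum>i\<le>d div 2. \<Sum>h\<le>H. ?t i h)"
  proof (rule sum_symmetric_halves)
    fix i assume "i \<le> d"
    then have "layer_card (d - i) h = layer_card i h" "d - (d - i) = i" for h
      using d_pos by (auto simp: layer_card_def)
    moreover have "potential_at b a * (g b - g a) = potential_at a b * (g a - g b)" for a b
      by (simp add: potential_at_def algebra_simps)
    ultimately show "(\<Sum>h\<le>H. ?t (d - i) h) = (\<Sum>h\<le>H. ?t i h)"
      by (intro sum.cong refl) metis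
  next
    fix i assume "2 * i = d"
    then have "d - i = i" by simp
    then show "(\<Sum>h\<le>H. ?t i h) = 0" by simp
  qed
  also have "(\<Sum>i\<le>d div 2. \<Sum>h\<le>H. ?t i h) = (\<Sum>i\<le>d div 2. \<Sum>h\<le>H. layer_term g i h)"
    by (intro sum.cong refl potential_at_layer_term) simp
  also have "\<dots> = (\<Sum>i\<le>d div 2. \<Sum>h. layer_term g i h)"
    by (intro sum.cong refl suminf_finite[symmetric]) (auto intro: layer_term_eq_0[OF support])
  finally show ?thesis .
qed

lemma suminf_layer_term_interior:
  assumes "finite {m. g m \<noteq> 0}" "0 < i" "i < d"
  shows "(\<Sum>h. layer_term g i h) = (g i - g (d - i)) * (real d / 2 - real i) +
    (\<Sum>h. if h \<ge> 1
       then (real q - 1) * real q ^ (h - 1) * (g (i + h) - g (d - i + h)) * (real d / 2 - real i + real h)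
       else 0)" (is "_ = _ + suminf ?s")
proof -
  obtain H where "{m. g m \<noteq> 0} \<subseteq> {..H}" using assms(1) finite_nat_iff_bounded_le by blast
  note vanish = layer_term_eq_0[OF this]
  define tail where "tail h = (if h = 0 then 0 else layer_term g i h)" for h
  have "?s = tail"
  proof
    show "?s h = tail h" for h
      using layer_term_interior(2)[OF assms(2,3), of g "h - 1"] by (cases h) (simp_all add: tail_def)
  qed
  moreover have "summable (layer_term g i)" "summable tail"
    by (rule summable_finite[of "{..H}"]; simp add: vanish tail_def)+
  then have "(\<Sum>h. layer_term g i h) = layer_term g i 0 + (\<Sum>h. layer_term g i (Suc h))"
    and "suminf tail = (\<Sum>h. layer_term g i (Suc h))"
    using suminf_split_head[of "layer_term g i"] suminf_split_head[of tail] by (simp_all add: tail_def)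
  ultimately show ?thesis using layer_term_interior(1)[OF assms(2,3)] by simp
qed

lemma W1_eq_series:
  assumes "radial g X \<rho>" "radial g Y \<sigma>"
  shows "W1 G \<rho> \<sigma> =
      2 * (\<Sum>h. real q ^ h * (g h - g (h + d)) * (real d / 2 + real h))
    + 2 * (\<Sum>i = 1..d div 2. (g i - g (d - i)) * (real d / 2 - real i))
    + 2 * (\<Sum>i = 1..d div 2. \<Sum>h. if h \<ge> 1
             then (real q - 1) * real q ^ (h - 1) * (g (i + h) - g (d - i + h))
                    * (real d / 2 - real i + real h)
             else 0)" (is "_ = 2 * ?S1 + 2 * ?S2 + 2 * ?S3")
proof -
  have "(\<Sum>i\<le>d div 2. \<Sum>h. layer_term g i h) =
      (\<Sum>h. layer_term g 0 h) + (\<Sum>i = 1..d div 2. \<Sum>h. layer_term g i h)"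
    unfolding atMost_atLeast0 by (subst sum.atLeast_Suc_atMost) simp_all
  also have "(\<Sum>h. layer_term g 0 h) = ?S1"
    by (simp only: layer_term_0)
  also have "(\<Sum>i = 1..d div 2. \<Sum>h. layer_term g i h) = ?S2 + ?S3"
    unfolding sum.distrib[symmetric]
    by (intro sum.cong refl suminf_layer_term_interior radial_finite_support[OF assms(1)]) auto
  finally show ?thesis by (simp add: W1_eq_sum_layer_term[OF assms])
qed

end

theorem theorem5p1:
  fixes q d n :: nat
    and T :: "'a pair_pre_digraph"
    and \<mu> :: "'a \<Rightarrow> nat \<Rightarrow> 'a pmf"
    and g :: "nat \<Rightarrow> nat \<Rightarrow> real"
    and X Y :: 'a
  assumes "q \<ge> 2" and "d \<ge> 1"
    and "regular_tree (q + 1) T"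
    and "\<And>u n. u \<in> pverts T \<Longrightarrow> set_pmf (\<mu> u n) \<subseteq> pverts T"
    and "\<And>u n. u \<in> pverts T \<Longrightarrow> finite (set_pmf (\<mu> u n))"
    and "\<And>u v u' v' n. u \<in> pverts T \<Longrightarrow> v \<in> pverts T \<Longrightarrow> u' \<in> pverts T \<Longrightarrow> v' \<in> pverts T \<Longrightarrow>
           graph_dist T u v = graph_dist T u' v' \<Longrightarrow> pmf (\<mu> u n) v = pmf (\<mu> u' n) v'"
    and "\<And>u v n. u \<in> pverts T \<Longrightarrow> v \<in> pverts T \<Longrightarrow> g (graph_dist T u v) n = pmf (\<mu> u n) v"
    and "X \<in> pverts T" and "Y \<in> pverts T" and "graph_dist T X Y = d"
  shows "W1 T (\<mu> X n) (\<mu> Y n) =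
      2 * (\<Sum>h. real q ^ h * (g h n - g (h + d) n) * (real d / 2 + real h))
    + 2 * (\<Sum>i = 1..d div 2. (g i n - g (d - i) n) * (real d / 2 - real i))
    + 2 * (\<Sum>i = 1..d div 2. \<Sum>h. if h \<ge> 1
             then (real q - 1) * real q ^ (h - 1) * (g (i + h) n - g (d - i + h) n)
                    * (real d / 2 - real i + real h)
             else 0)"
proof -
  interpret regular_pair_tree T q
    using assms(1,3) by (intro regular_pair_treeI) simp_all
  interpret regular_pair_tree_two_points T q X Y
    using assms(2,8-10) by unfold_locales auto
  have "radial (\<lambda>m. g m n) u (\<mu> u n)" if "u \<in> pverts T" for u
    using that assms(4,5,7) by (auto simp: radial_def)
  then show ?thesis
    using W1_eq_series[of "\<lambda>m. g m n" "\<mu> X n" "\<mu> Y n"] assms(8,9)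
    unfolding \<open>graph_dist T X Y = d\<close> by blast
qed

end
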